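(* Let $(X_n)_{n\in\mathbb{Z}}$ be a Markov chain on a finite state space $\mathbb{S}$ with $M$-periodic transition matrices $P_m=(P_{m,ij})_{i,j\in\mathbb{S}}$, $m\in\{0,\dots,M-1\}$, such that $\bar P_0=P_0P_1\cdots P_{M-1}$ is irreducible and the chain is $M$-stationary. Then the $M$-periodic forward committor $q^+_m=(q^+_{m,i})_{i\in\mathbb{S}}$ satisfies, for $m\in\{0,\dots,M-1\}$ and with the periodic condition $q^+_M=q^+_0$, $$\begin{cases} q^+_{m,i}=\sum_{j\in\mathbb{S}}P_{m,ij}\,q^+_{m+1,j} & i\in C,\\ q^+_{m,i}=0 & i\in A,\\ q^+_{m,i}=1& i\in B,\end{cases}$$ and the $M$-periodic backward committor $q^-_m=(q^-_{m,i})_{i\in\mathbb{S}}$ satisfies, for $m\in\{1,\dots,M\}$ (time indices modulo $M$) and with $q^-_M=q^-_0$, $$\begin{cases} q^-_{m,i}=\sum_{j\in\mathbb{S}}P^-_{m,ij}\,q^-_{m-1,j} & i\in C,\\ q^-_{m,i}=0 & i\in B,\\ q^-_{m,i}=1& i\in A.\end{cases}$$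
   Context: $A,B\subset\mathbb{S}$ are non-empty disjoint subsets of the finite state space $\mathbb{S}$ with $C:=(A\cup B)^c$ non-empty. Periodic setting: the transition matrices $P_{ij}(n)=\mathbb{P}(X_{n+1}=j\mid X_n=i)$, $n\in\mathbb{Z}$, are row-stochastic and satisfy $P(n)=P(n+M)$ for all $n\in\mathbb{Z}$, with period $M\in\mathbb{N}$, $M\ge 1$. One writes $P_m:=P(n)$ whenever $n\equiv m \pmod M$; all subscripts $m$ are read modulo $M$. $\bar P_m:=P_mP_{m+1}\cdots P_{m+M-1}$. If $\bar P_0$ is irreducible, there is a unique family of probability vectors $(\pi_m)_{m}$ with $\pi_m^\top\bar P_m=\pi_m^\top$ and $\pi_{m+1}^\top=\pi_m^\top P_m$ for all $m$ modulo $M$. The chain is $M$-stationary if $\mathbb{P}(X_n=i)=\pi_{m,i}$ whenever $n\equiv m\pmod M$. Backward transition probabilities: $P^-_{m,ij}:=\mathbb{P}(X_{n-1}=j\mid X_n=i)=P_{m-1,ji}\,\pi_{m-1,j}/\pi_{m,i}$ for $n\equiv m\pmod M$ if $\pi_{m,i}>0$, and $P^-_{m,ij}:=0$ if $\pi_{m,i}=0$. First entrance and last exit times of $S\subset\mathbb{S}$: $\tau^+_S(n):=\inf\{k\ge n: X_k\in S\}$ ($\inf\emptyset:=\infty$), $\tau^-_S(n):=\sup\{k\le n: X_k\in S\}$ ($\sup\emptyset:=-\infty$), with $k\in\mathbb{Z}$. Committors: $q_i^+(n):=\mathbb{P}(\tau_B^+(n)<\tau_A^+(n)\mid X_n=i)$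 and $q_i^-(n):=\mathbb{P}(\tau_A^-(n)>\tau_B^-(n)\mid X_n=i)$. They depend only on $n$ modulo $M$, and $q^\pm_m:=q^\pm(n)$ for $n\equiv m\pmod M$. Convention for states with $\mathbb{P}(X_n=i)=0$: $q_i^+(n)$ is the probability of $\{\tau_B^+(n)<\tau_A^+(n)\}$ for the chain with the given transition matrices started at time $n$ in $i$; $q_i^-(n)$ is set to $1$ if $i\in A$ and to $0$ otherwise. *)

theory Defs
  imports
    "HOL-Probability.Probability"
    "HOL-Number_Theory.Cong"
begin

text \<open>
  The finite state space is a type \<open>'s\<close> of class \<open>finite\<close>. Time is \<open>int\<close>, and an \<open>M\<close>-periodic family
  (subscripts modulo \<open>M\<close>) is a family over \<open>int\<close> together with a periodicity condition.
\<close>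

definition row_stochastic :: "real^'s^'s \<Rightarrow> bool" where
  "row_stochastic Q \<longleftrightarrow> (\<forall>i j. 0 \<le> Q $ i $ j) \<and> (\<forall>i. (\<Sum>j\<in>UNIV. Q $ i $ j) = 1)"

definition probability_vector :: "real^'s \<Rightarrow> bool" where
  "probability_vector v \<longleftrightarrow> (\<forall>i. 0 \<le> v $ i) \<and> (\<Sum>i\<in>UNIV. v $ i) = 1"

definition periodic :: "nat \<Rightarrow> (int \<Rightarrow> 'a) \<Rightarrow> bool" where
  "periodic M f \<longleftrightarrow> (\<forall>n. f (n + int M) = f n)"

text \<open>\<open>transition_product P m k\<close> is \<open>P m ** P (m + 1) ** \<dots> ** P (m + k - 1)\<close>, so
  \<open>transition_product P m M\<close> is the transition matrix over one period starting at \<open>m\<close>.\<close>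

primrec transition_product :: "(int \<Rightarrow> real^'s^'s) \<Rightarrow> int \<Rightarrow> nat \<Rightarrow> real^'s^'s" where
  "transition_product P m 0 = mat 1"
| "transition_product P m (Suc k) = transition_product P m k ** P (m + int k)"

text \<open>The power is written with iteration of \<open>**\<close> because \<open>^\<close> and \<open>*\<close> on \<open>real^'s^'s\<close> are
  componentwise.\<close>

definition irreducible_matrix :: "real^'s^'s \<Rightarrow> bool" where
  "irreducible_matrix Q \<longleftrightarrow> (\<forall>i j. \<exists>k>0. 0 < (((**) Q) ^^ k) (mat 1) $ i $ j)"

definition stationary_family :: "(int \<Rightarrow> real^'s^'s) \<Rightarrow> nat \<Rightarrow> (int \<Rightarrow> real^'s) \<Rightarrow> bool" where
  "stationary_family P M \<pi> \<longleftrightarrow>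
     periodic M \<pi> \<and>
     (\<forall>m. probability_vector (\<pi> m)) \<and>
     (\<forall>m. \<pi> m v* transition_product P m M = \<pi> m) \<and>
     (\<forall>m. \<pi> (m + 1) = \<pi> m v* P m)"

text \<open>Two-sided chain: the transition probabilities are prescribed given every finite past
  \<open>X (n - k), \<dots>, X n\<close> of positive probability (\<open>k = 0\<close> gives the one-step transition probabilities).\<close>

definition markov_chain :: "'w measure \<Rightarrow> (int \<Rightarrow> 'w \<Rightarrow> 's) \<Rightarrow> (int \<Rightarrow> real^'s^'s) \<Rightarrow> bool" where
  "markov_chain \<Omega> X P \<longleftrightarrow>
     prob_space \<Omega> \<and>
     (\<forall>n. X n \<in> measurable \<Omega> (count_space UNIV)) \<and>
     (\<forall>n k x j.
        \<P>(\<omega> in \<Omega>. \<forall>l\<in>{n - int k..n}. X l \<omega> = x l) > 0 \<longrightarrow>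
        \<P>(\<omega> in \<Omega>. X (n + 1) \<omega> = j \<bar> \<forall>l\<in>{n - int k..n}. X l \<omega> = x l) = P n $ x n $ j)"

definition M_stationary :: "'w measure \<Rightarrow> (int \<Rightarrow> 'w \<Rightarrow> 's) \<Rightarrow> (int \<Rightarrow> real^'s) \<Rightarrow> bool" where
  "M_stationary \<Omega> X \<pi> \<longleftrightarrow> (\<forall>n i. \<P>(\<omega> in \<Omega>. X n \<omega> = i) = \<pi> n $ i)"

definition backward_transition ::
  "'w measure \<Rightarrow> (int \<Rightarrow> 'w \<Rightarrow> 's) \<Rightarrow> (int \<Rightarrow> real^'s) \<Rightarrow> int \<Rightarrow> 's \<Rightarrow> 's \<Rightarrow> real" where
  "backward_transition \<Omega> X \<pi> m i j =
     (if \<pi> m $ i > 0 then \<P>(\<omega> in \<Omega>. X (m - 1) \<omega> = j \<bar> X m \<omega> = i) else 0)"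

text \<open>Random times are functions of the trajectory \<open>x :: int \<Rightarrow> 's\<close> with values in \<open>ereal\<close>, where
  \<open>Inf {} = \<infinity>\<close> and \<open>Sup {} = -\<infinity>\<close>.\<close>

definition first_entrance :: "'s set \<Rightarrow> int \<Rightarrow> (int \<Rightarrow> 's) \<Rightarrow> ereal" where
  "first_entrance S n x = Inf ((\<lambda>k. ereal (real_of_int k)) ` {k. k \<ge> n \<and> x k \<in> S})"

definition last_exit :: "'s set \<Rightarrow> int \<Rightarrow> (int \<Rightarrow> 's) \<Rightarrow> ereal" where
  "last_exit S n x = Sup ((\<lambda>k. ereal (real_of_int k)) ` {k. k \<le> n \<and> x k \<in> S})"

text \<open>Law on \<open>nat \<Rightarrow> 's\<close> of the chain with transition matrices \<open>P\<close> started at time \<open>n\<close> in \<open>i\<close>;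
  coordinate \<open>k\<close> is the state at time \<open>n + k\<close>. It is the Ionescu-Tulcea measure of the kernels
  \<open>started_kernel P n i k\<close>, which give the distribution of coordinate \<open>k\<close> given the earlier ones;
  \<open>embed_pmf\<close> is only meaningful for row-stochastic \<open>P\<close>.\<close>

definition started_kernel ::
  "(int \<Rightarrow> real^'s^'s) \<Rightarrow> int \<Rightarrow> 's \<Rightarrow> nat \<Rightarrow> (nat \<Rightarrow> 's) \<Rightarrow> 's measure" where
  "started_kernel P n i k y =
     (case k of
        0 \<Rightarrow> measure_pmf (return_pmf i)
      | Suc l \<Rightarrow> measure_pmf (embed_pmf (\<lambda>j. P (n + int l) $ y l $ j)))"

definition started_law :: "(int \<Rightarrow> real^'s^'s) \<Rightarrow> int \<Rightarrow> 's \<Rightarrow> (nat \<Rightarrow> 's) measure" where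
  "started_law P n i =
     projective_family.lim UNIV
       (Ionescu_Tulcea.CI (started_kernel P n i) (\<lambda>_. count_space UNIV)) (\<lambda>_. count_space UNIV)"

lemma Ionescu_Tulcea_started_kernel:
  "Ionescu_Tulcea (started_kernel P n (i :: 's :: finite)) (\<lambda>_. count_space UNIV)"
proof (intro Ionescu_Tulcea.intro)
  fix k :: nat
  show "started_kernel P n i k
      \<in> measurable (PiM {0..<k} (\<lambda>_. count_space UNIV)) (subprob_algebra (count_space UNIV))"
  proof (cases k)
    case 0
    have "(\<lambda>_. measure_pmf (return_pmf i))
        \<in> measurable (PiM {0..<k} (\<lambda>_. count_space UNIV)) (subprob_algebra (count_space UNIV))"
      by (rule measurable_const) (rule measure_pmf_in_subprob_algebra)
    with 0 show ?thesis
      by (simp add: started_kernel_def[abs_def])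
  next
    case (Suc l)
    have "(\<lambda>y. y l) \<in> measurable (PiM {0..<k} (\<lambda>_. count_space (UNIV :: 's set))) (count_space UNIV)"
      using Suc by (intro measurable_component_singleton) simp
    moreover have "(\<lambda>s. measure_pmf (embed_pmf (\<lambda>j. P (n + int l) $ s $ j)))
        \<in> measurable (count_space UNIV) (subprob_algebra (count_space UNIV))"
      by (simp add: measure_pmf_in_subprob_algebra)
    ultimately have "(\<lambda>y. measure_pmf (embed_pmf (\<lambda>j. P (n + int l) $ y l $ j)))
        \<in> measurable (PiM {0..<k} (\<lambda>_. count_space UNIV)) (subprob_algebra (count_space UNIV))"
      by (rule measurable_compose)
    with Suc show ?thesis
      by (simp add: started_kernel_def[abs_def])
  qed
next
  show "prob_space (started_kernel P n i k y)" for k y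
    by (cases k) (simp_all add: started_kernel_def measure_pmf.prob_space_axioms)
qed

lemma
  fixes i :: "'s :: finite"
  shows sets_started_law: "sets (started_law P n i) = sets (PiM UNIV (\<lambda>_. count_space UNIV))"
    and prob_space_started_law: "prob_space (started_law P n i)"
proof -
  interpret Ionescu_Tulcea "started_kernel P n i" "\<lambda>_. count_space (UNIV :: 's set)"
    by (rule Ionescu_Tulcea_started_kernel)
  show "sets (started_law P n i) = sets (PiM UNIV (\<lambda>_. count_space UNIV))"
    unfolding started_law_def by (rule PF.sets_lim)
  have "emeasure (started_law P n i) (PF.emb UNIV {} {\<lambda>_. undefined}) = emeasure (CI {}) {\<lambda>_. undefined}"
    unfolding started_law_def by (rule lim) (auto simp: PiM_empty)
  moreover have "prob_space (CI {})"
    by (rule PF.prob_space_P) auto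
  moreover have "space (CI {}) = {\<lambda>_. undefined}"
    by (simp add: PF.space_P space_PiM)
  ultimately have "emeasure (started_law P n i) (PF.emb UNIV {} {\<lambda>_. undefined}) = 1"
    by (metis prob_space.emeasure_space_1)
  moreover have "PF.emb UNIV {} {\<lambda>_. undefined} = space (started_law P n i)"
    unfolding started_law_def by (simp add: prod_emb_def PF.space_lim space_PiM PiE_UNIV_domain restrict_def)
  ultimately show "prob_space (started_law P n i)"
    by (intro prob_spaceI) simp
qed

text \<open>The second branch is the convention for states with \<open>\<P>(X n = i) = 0\<close>.\<close>

definition forward_committor ::
  "'w measure \<Rightarrow> (int \<Rightarrow> 'w \<Rightarrow> 's) \<Rightarrow> (int \<Rightarrow> real^'s^'s) \<Rightarrow> 's set \<Rightarrow> 's set \<Rightarrow> int \<Rightarrow> 's \<Rightarrow> real" where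
  "forward_committor \<Omega> X P A B n i =
     (if \<P>(\<omega> in \<Omega>. X n \<omega> = i) > 0
      then \<P>(\<omega> in \<Omega>. first_entrance B n (\<lambda>k. X k \<omega>) < first_entrance A n (\<lambda>k. X k \<omega>) \<bar> X n \<omega> = i)
      else \<P>(y in started_law P n i.
              first_entrance B n (\<lambda>k. y (nat (k - n))) < first_entrance A n (\<lambda>k. y (nat (k - n)))))"

definition backward_committor ::
  "'w measure \<Rightarrow> (int \<Rightarrow> 'w \<Rightarrow> 's) \<Rightarrow> 's set \<Rightarrow> 's set \<Rightarrow> int \<Rightarrow> 's \<Rightarrow> real" where
  "backward_committor \<Omega> X A B n i =
     (if \<P>(\<omega> in \<Omega>. X n \<omega> = i) > 0
      then \<P>(\<omega> in \<Omega>. last_exit A n (\<lambda>k. X k \<omega>) > last_exit B n (\<lambda>k. X k \<omega>) \<bar> X n \<omega> = i)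
      else if i \<in> A then 1 else 0)"

text \<open>For periodic \<open>P\<close> and \<open>\<pi>\<close> this shows that \<open>backward_transition \<Omega> X \<pi> m\<close> depends on \<open>m\<close> only
  modulo the period.\<close>

lemma backward_transition_eq:
  assumes "markov_chain \<Omega> X P" and stat: "M_stationary \<Omega> X \<pi>" and pos: "\<pi> m $ i > 0"
  shows "backward_transition \<Omega> X \<pi> m i j = P (m - 1) $ j $ i * \<pi> (m - 1) $ j / \<pi> m $ i"
proof -
  interpret prob_space \<Omega> using assms(1) by (simp add: markov_chain_def)
  have [measurable]: "X n \<in> measurable \<Omega> (count_space UNIV)" for n
    using assms(1) by (simp add: markov_chain_def)
  have p: "\<P>(\<omega> in \<Omega>. X n \<omega> = a) = \<pi> n $ a" for n a
    using stat by (simp add: M_stationary_def)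
  let ?J = "\<P>(\<omega> in \<Omega>. X (m - 1) \<omega> = j \<and> X m \<omega> = i)"
  have "?J = P (m - 1) $ j $ i * \<pi> (m - 1) $ j"
  proof (cases "\<P>(\<omega> in \<Omega>. X (m - 1) \<omega> = j) > 0")
    case True
    have "\<P>(\<omega> in \<Omega>. \<forall>l\<in>{m - 1 - int 0..m - 1}. X l \<omega> = j) > 0 \<longrightarrow>
        \<P>(\<omega> in \<Omega>. X (m - 1 + 1) \<omega> = i \<bar> \<forall>l\<in>{m - 1 - int 0..m - 1}. X l \<omega> = j)
          = P (m - 1) $ j $ i"
      using assms(1) unfolding markov_chain_def
      by (elim conjE allE[of _ "m - 1"] allE[of _ "0 :: nat"] allE[of _ "\<lambda>_. j"] allE[of _ i]) assumption
    with True have "\<P>(\<omega> in \<Omega>. X m \<omega> = i \<bar> X (m - 1) \<omega> = j) = P (m - 1) $ j $ i"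
      by simp
    then show ?thesis
      using True by (simp add: cond_prob_def p field_simps conj_commute)
  next
    case False
    then have z: "\<P>(\<omega> in \<Omega>. X (m - 1) \<omega> = j) = 0"
      using measure_nonneg[of \<Omega> "{\<omega> \<in> space \<Omega>. X (m - 1) \<omega> = j}"] by linarith
    have "?J \<le> \<P>(\<omega> in \<Omega>. X (m - 1) \<omega> = j)"
      by (intro finite_measure_mono) auto
    with z have "?J = 0" using measure_nonneg[of \<Omega>] by (metis order_antisym)
    with z show ?thesis by (simp add: p)
  qed
  then show ?thesis
    using pos by (simp add: backward_transition_def cond_prob_def p)
qed

end

theory Submission
  imports Defs
begin

text \<open>
  The committor equations are a first-step analysis. A committor is the probability that a path
  enters a set \<open>S\<close> before a set \<open>R\<close>. If the path starts in \<open>S\<close> or in \<open>R\<close>, this is decided at once;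
  otherwise one conditions on the next state and restarts the path there. The forward committor
  follows the chain forwards in time (\<open>S = B\<close>, \<open>R = A\<close>). The backward committor follows it backwards
  (\<open>S = A\<close>, \<open>R = B\<close>), since the chain read backwards is again a Markov chain, with transition
  matrices \<open>P\<^sup>-\<close>.

  The argument is carried out with a finite horizon first. The numbers
  \<open>hit_prob S R p Q i\<close> are defined by the first-step recursion in \<open>p\<close>, from the transition
  probabilities \<open>Q\<close> alone. The Markov property identifies them with the probabilities of entering
  \<open>S\<close> before \<open>R\<close> within \<open>p\<close> steps (\<open>prob_hits_within_given_past\<close>), and by continuity from below they
  converge to the committors as \<open>p \<rightarrow> \<infinity>\<close> (\<open>forward_committor_limit\<close>, \<open>backward_committor_limit\<close>).
  As the sum over the finite state space commutes with this limit, the recursion becomes the committor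
  equations (\<open>hit_prob_limit_rec\<close>).

  States of probability zero fit into the same scheme. In the forward direction the committor of such
  a state is a probability for the started chain, which is a Markov path with the same \<open>Q\<close>. In the
  backward direction the row of \<open>P\<^sup>-\<close> vanishes, so that \<open>hit_prob\<close> is the indicator of \<open>A\<close>, in
  accordance with the convention.

  The committors are periodic because these limits are determined by \<open>Q\<close>, which does not change when
  time is shifted by \<open>M\<close>.
\<close>

section \<open>Hitting one set before another in finitely many steps\<close>

definition hits_within :: "'s set \<Rightarrow> 's set \<Rightarrow> (nat \<Rightarrow> 's) \<Rightarrow> nat \<Rightarrow> bool" where
  "hits_within S R y p \<longleftrightarrow> (\<exists>k\<le>p. y k \<in> S \<and> (\<forall>l\<le>k. y l \<notin> R))"

text \<open>\<open>Q l i j\<close> is the probability of going from \<open>i\<close> to \<open>j\<close> in step \<open>l\<close>. The recursion shifts \<open>Q\<close> because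
  the chain restarted after its first step uses the later transition probabilities; thus one
  recursion serves both directions of time.\<close>

primrec hit_prob ::
  "'s::finite set \<Rightarrow> 's set \<Rightarrow> nat \<Rightarrow> (nat \<Rightarrow> 's \<Rightarrow> 's \<Rightarrow> real) \<Rightarrow> 's \<Rightarrow> real" where
  "hit_prob S R 0 Q i = (if i \<in> S then 1 else 0)"
| "hit_prob S R (Suc p) Q i =
     (if i \<in> S then 1 else if i \<in> R then 0
      else (\<Sum>j\<in>UNIV. Q 0 i j * hit_prob S R p (\<lambda>l. Q (Suc l)) j))"

lemma hits_within_start: "y 0 \<in> S \<Longrightarrow> S \<inter> R = {} \<Longrightarrow> hits_within S R y p"
  unfolding hits_within_def by (intro exI[of _ 0]) auto

lemma not_hits_within_start: "y 0 \<in> R \<Longrightarrow> \<not> hits_within S R y p"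
  unfolding hits_within_def by auto

lemma hits_within_0: "S \<inter> R = {} \<Longrightarrow> hits_within S R y 0 \<longleftrightarrow> y 0 \<in> S"
  unfolding hits_within_def by auto

lemma hits_within_Suc:
  assumes "y 0 \<notin> S" "y 0 \<notin> R"
  shows "hits_within S R y (Suc p) \<longleftrightarrow> hits_within S R (\<lambda>l. y (Suc l)) p"
proof
  assume "hits_within S R y (Suc p)"
  then obtain k where k: "k \<le> Suc p" "y k \<in> S" "\<forall>l\<le>k. y l \<notin> R"
    unfolding hits_within_def by blast
  with assms obtain k' where "k = Suc k'" by (cases k) auto
  with k show "hits_within S R (\<lambda>l. y (Suc l)) p"
    unfolding hits_within_def by (intro exI[of _ k']) auto
next
  assume "hits_within S R (\<lambda>l. y (Suc l)) p"
  then obtain k where k: "k \<le> p" "y (Suc k) \<in> S" "\<forall>l\<le>k. y (Suc l) \<notin> R"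
    unfolding hits_within_def by blast
  have "y l \<notin> R" if "l \<le> Suc k" for l
    using that k(3) assms(2) by (cases l) auto
  with k show "hits_within S R y (Suc p)"
    unfolding hits_within_def by (intro exI[of _ "Suc k"]) auto
qed

lemma hits_within_mono: "hits_within S R y p \<Longrightarrow> p \<le> p' \<Longrightarrow> hits_within S R y p'"
  unfolding hits_within_def by (meson le_trans)

lemma ex_hits_within: "(\<exists>p. hits_within S R y p) \<longleftrightarrow> (\<exists>k. y k \<in> S \<and> (\<forall>l\<le>k. y l \<notin> R))"
  unfolding hits_within_def by blast

text \<open>In the limit of an infinite horizon the recursion turns into an equation between the limits:
  \<open>p\<close> and \<open>Suc p\<close> give the same limit, and a finite sum commutes with it.\<close>

lemma hit_prob_limit_rec:
  fixes Q :: "nat \<Rightarrow> 's::finite \<Rightarrow> 's \<Rightarrow> real"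
  assumes lim: "(\<lambda>p. hit_prob S R p Q i) \<longlonglongrightarrow> a"
    and next_lim: "\<And>j. (\<lambda>p. hit_prob S R p (\<lambda>l. Q (Suc l)) j) \<longlonglongrightarrow> b j"
  shows "a = (if i \<in> S then 1 else if i \<in> R then 0 else (\<Sum>j\<in>UNIV. Q 0 i j * b j))"
proof -
  have "(\<lambda>p. \<Sum>j\<in>UNIV. Q 0 i j * hit_prob S R p (\<lambda>l. Q (Suc l)) j)
      \<longlonglongrightarrow> (\<Sum>j\<in>UNIV. Q 0 i j * b j)"
    by (intro tendsto_intros next_lim)
  then have "(\<lambda>p. hit_prob S R (Suc p) Q i)
      \<longlonglongrightarrow> (if i \<in> S then 1 else if i \<in> R then 0 else (\<Sum>j\<in>UNIV. Q 0 i j * b j))"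
    by simp
  with LIMSEQ_Suc[OF lim] show ?thesis
    by (rule LIMSEQ_unique)
qed

section \<open>One-sided Markov paths\<close>

text \<open>The Markov property is assumed in product form, for finite cylinders. In this form it makes
  sense also when the past has probability zero, and it can be read off from the cylinder
  probabilities of a time-reversed chain.\<close>

locale markov_path = prob_space N
  for N :: "'w measure" and Y :: "nat \<Rightarrow> 'w \<Rightarrow> 's::finite" and Q :: "nat \<Rightarrow> 's \<Rightarrow> 's \<Rightarrow> real" +
  assumes measurable_path [measurable]: "\<And>l. Y l \<in> measurable N (count_space UNIV)"
    and path_step: "\<And>k x. \<P>(\<omega> in N. \<forall>l\<le>Suc k. Y l \<omega> = x l)
          = \<P>(\<omega> in N. \<forall>l\<le>k. Y l \<omega> = x l) * Q k (x k) (x (Suc k))"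
begin

lemma measurable_hits_within [measurable]:
  "Measurable.pred N (\<lambda>\<omega>. hits_within S R (\<lambda>l. Y (k + l) \<omega>) p)"
  unfolding hits_within_def by measurable

text \<open>The Markov property for hitting events. For the induction on the horizon \<open>p\<close> the whole past
  \<open>x 0, \<dots>, x k\<close> has to be carried along, with \<open>k\<close> and \<open>x\<close> arbitrary: when \<open>x k\<close> lies outside \<open>S\<close> and
  \<open>R\<close>, the event is split according to the next state \<open>j\<close>, and the induction hypothesis is applied
  to the past extended by \<open>j\<close>.\<close>

lemma prob_hits_within_given_past:
  assumes "S \<inter> R = {}"
  shows "\<P>(\<omega> in N. (\<forall>l\<le>k. Y l \<omega> = x l) \<and> hits_within S R (\<lambda>l. Y (k + l) \<omega>) p)
      = \<P>(\<omega> in N. \<forall>l\<le>k. Y l \<omega> = x l) * hit_prob S R p (\<lambda>l. Q (k + l)) (x k)"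
proof (induction p arbitrary: k x)
  case 0
  have "((\<forall>l\<le>k. Y l \<omega> = x l) \<and> hits_within S R (\<lambda>l. Y (k + l) \<omega>) 0)
      \<longleftrightarrow> (\<forall>l\<le>k. Y l \<omega> = x l) \<and> x k \<in> S" for \<omega>
    using assms by (auto simp: hits_within_0)
  then show ?case by simp
next
  case (Suc p)
  consider "x k \<in> S" | "x k \<in> R" | "x k \<notin> S" "x k \<notin> R" by blast
  then show ?case
  proof cases
    case 1
    then have "((\<forall>l\<le>k. Y l \<omega> = x l) \<and> hits_within S R (\<lambda>l. Y (k + l) \<omega>) (Suc p))
      \<longleftrightarrow> (\<forall>l\<le>k. Y l \<omega> = x l)" for \<omega>
      using assms by (auto intro!: hits_within_start)
    with 1 show ?thesis by simp
  next
    case 2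
    have none: "{\<omega> \<in> space N. (\<forall>l\<le>k. Y l \<omega> = x l) \<and> hits_within S R (\<lambda>l. Y (k + l) \<omega>) (Suc p)} = {}"
      using 2 not_hits_within_start[where R = R] by fastforce
    have "x k \<notin> S" using 2 assms by blast
    with 2 show ?thesis unfolding none by simp
  next
    case 3
    let ?E = "\<lambda>j \<omega>. (\<forall>l\<le>Suc k. Y l \<omega> = (x(Suc k := j)) l)
      \<and> hits_within S R (\<lambda>l. Y (Suc k + l) \<omega>) p"
    have upd: "(\<forall>l\<le>Suc k. Y l \<omega> = (x(Suc k := j)) l)
        \<longleftrightarrow> (\<forall>l\<le>k. Y l \<omega> = x l) \<and> Y (Suc k) \<omega> = j" for j \<omega>
      by (auto simp: le_Suc_eq)
    have eq: "((\<forall>l\<le>k. Y l \<omega> = x l) \<and> hits_within S R (\<lambda>l. Y (k + l) \<omega>) (Suc p))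
        \<longleftrightarrow> (\<exists>j. ?E j \<omega>)" for \<omega>
      unfolding upd using 3 hits_within_Suc[of "\<lambda>l. Y (k + l) \<omega>" S R p] by auto
    have "\<P>(\<omega> in N. (\<forall>l\<le>k. Y l \<omega> = x l) \<and> hits_within S R (\<lambda>l. Y (k + l) \<omega>) (Suc p))
        = prob (\<Union>j\<in>UNIV. {\<omega> \<in> space N. ?E j \<omega>})"
      unfolding eq by (intro arg_cong[where f = prob]) auto
    also have "\<dots> = (\<Sum>j\<in>UNIV. \<P>(\<omega> in N. ?E j \<omega>))"
    proof (rule finite_measure_finite_Union)
      show "(\<lambda>j. {\<omega> \<in> space N. ?E j \<omega>}) ` UNIV \<subseteq> events"
        by (intro image_subsetI) measurable
      show "disjoint_family (\<lambda>j. {\<omega> \<in> space N. ?E j \<omega>})"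
        unfolding disjoint_family_on_def upd by blast
    qed simp
    also have "\<dots> = (\<Sum>j\<in>UNIV. \<P>(\<omega> in N. \<forall>l\<le>k. Y l \<omega> = x l) * Q k (x k) j
        * hit_prob S R p (\<lambda>l. Q (Suc k + l)) j)"
    proof (rule sum.cong[OF refl])
      fix j
      have "\<P>(\<omega> in N. \<forall>l\<le>k. Y l \<omega> = (x(Suc k := j)) l) = \<P>(\<omega> in N. \<forall>l\<le>k. Y l \<omega> = x l)"
        by (intro arg_cong[where f = prob]) auto
      then show "\<P>(\<omega> in N. ?E j \<omega>) = \<P>(\<omega> in N. \<forall>l\<le>k. Y l \<omega> = x l) * Q k (x k) j
          * hit_prob S R p (\<lambda>l. Q (Suc k + l)) j"
        unfolding Suc.IH path_step by simp
    qed
    finally show ?thesis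
      using 3 by (simp add: sum_distrib_left mult.assoc)
  qed
qed

text \<open>The events of hitting within \<open>p\<close> steps increase to the event of hitting at all, so their
  probabilities converge. The unnormalized form holds for every \<open>i\<close>.\<close>

lemma prob_hits_from_start:
  assumes "S \<inter> R = {}"
  shows "(\<lambda>p. \<P>(\<omega> in N. Y 0 \<omega> = i) * hit_prob S R p Q i)
    \<longlonglongrightarrow> \<P>(\<omega> in N. Y 0 \<omega> = i \<and> (\<exists>p. hits_within S R (\<lambda>l. Y l \<omega>) p))"
proof -
  let ?E = "\<lambda>p. {\<omega> \<in> space N. Y 0 \<omega> = i \<and> hits_within S R (\<lambda>l. Y l \<omega>) p}"
  have [measurable]: "Measurable.pred N (\<lambda>\<omega>. hits_within S R (\<lambda>l. Y l \<omega>) p)" for p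
    using measurable_hits_within[of S R 0 p] by simp
  have "range ?E \<subseteq> events" by auto
  moreover have "incseq ?E"
    by (auto simp: incseq_def intro: hits_within_mono)
  ultimately have "(\<lambda>p. prob (?E p)) \<longlonglongrightarrow> prob (\<Union>p. ?E p)"
    by (rule finite_Lim_measure_incseq)
  moreover have "(\<Union>p. ?E p) = {\<omega> \<in> space N. Y 0 \<omega> = i \<and> (\<exists>p. hits_within S R (\<lambda>l. Y l \<omega>) p)}"
    by auto
  ultimately show ?thesis
    using prob_hits_within_given_past[OF assms, of 0 "\<lambda>_. i"] by simp
qed

lemma cond_prob_hits:
  assumes "S \<inter> R = {}" and pos: "\<P>(\<omega> in N. Y 0 \<omega> = i) > 0"
  shows "(\<lambda>p. hit_prob S R p Q i)
    \<longlonglongrightarrow> \<P>(\<omega> in N. \<exists>p. hits_within S R (\<lambda>l. Y l \<omega>) p \<bar> Y 0 \<omega> = i)"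
proof -
  have "(\<lambda>p. \<P>(\<omega> in N. Y 0 \<omega> = i) * hit_prob S R p Q i / \<P>(\<omega> in N. Y 0 \<omega> = i))
    \<longlonglongrightarrow> \<P>(\<omega> in N. Y 0 \<omega> = i \<and> (\<exists>p. hits_within S R (\<lambda>l. Y l \<omega>) p))
      / \<P>(\<omega> in N. Y 0 \<omega> = i)"
    using pos by (intro tendsto_divide tendsto_const prob_hits_from_start assms) auto
  then show ?thesis
    using pos by (simp add: cond_prob_def conj_commute)
qed

end

section \<open>Entrance and exit times as hitting events\<close>

text \<open>Strictness survives the passage to the infimum because integers above \<open>k\<close> are at least
  \<open>k + 1\<close>. The empty set, with infimum \<open>\<infinity>\<close>, is included.\<close>

lemma ereal_less_Inf_int_iff:
  "ereal (real_of_int k) < Inf ((\<lambda>l. ereal (real_of_int l)) ` L) \<longleftrightarrow> (\<forall>l\<in>L. k < l)"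
proof
  assume "ereal (real_of_int k) < Inf ((\<lambda>l. ereal (real_of_int l)) ` L)"
  then show "\<forall>l\<in>L. k < l"
    by (auto simp: less_INF_D dest: less_INF_D)
next
  assume "\<forall>l\<in>L. k < l"
  then have "ereal (real_of_int (k + 1)) \<le> Inf ((\<lambda>l. ereal (real_of_int l)) ` L)"
    by (intro INF_greatest) (auto simp del: of_int_add)
  moreover have "ereal (real_of_int k) < ereal (real_of_int (k + 1))"
    by simp
  ultimately show "ereal (real_of_int k) < Inf ((\<lambda>l. ereal (real_of_int l)) ` L)"
    by (rule less_le_trans[rotated])
qed

lemma first_entrance_less_iff:
  "first_entrance S n x < first_entrance R n x
    \<longleftrightarrow> (\<exists>p. hits_within S R (\<lambda>l. x (n + int l)) p)"
proof -
  have "first_entrance S n x < first_entrance R n x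
      \<longleftrightarrow> (\<exists>k\<ge>n. x k \<in> S \<and> (\<forall>l\<ge>n. x l \<in> R \<longrightarrow> k < l))"
    unfolding first_entrance_def Inf_less_iff[of "(\<lambda>k. ereal (real_of_int k)) ` {k. k \<ge> n \<and> x k \<in> S}"]
    by (auto simp: ereal_less_Inf_int_iff)
  also have "\<dots> \<longleftrightarrow> (\<exists>k. x (n + int k) \<in> S \<and> (\<forall>l\<le>k. x (n + int l) \<notin> R))"
  proof
    assume "\<exists>k\<ge>n. x k \<in> S \<and> (\<forall>l\<ge>n. x l \<in> R \<longrightarrow> k < l)"
    then obtain k where "k \<ge> n" "x k \<in> S" "\<forall>l\<ge>n. x l \<in> R \<longrightarrow> k < l" by blast
    moreover from this have "x (n + int l) \<notin> R" if "l \<le> nat (k - n)" for l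
      using that by (auto dest!: spec[of _ "n + int l"])
    ultimately show "\<exists>k. x (n + int k) \<in> S \<and> (\<forall>l\<le>k. x (n + int l) \<notin> R)"
      by (intro exI[of _ "nat (k - n)"]) simp
  next
    assume "\<exists>k. x (n + int k) \<in> S \<and> (\<forall>l\<le>k. x (n + int l) \<notin> R)"
    then obtain k where k: "x (n + int k) \<in> S" "\<forall>l\<le>k. x (n + int l) \<notin> R" by blast
    have "n + int k < l" if "l \<ge> n" "x l \<in> R" for l
      using k(2)[rule_format, of "nat (l - n)"] that by fastforce
    with k show "\<exists>k\<ge>n. x k \<in> S \<and> (\<forall>l\<ge>n. x l \<in> R \<longrightarrow> k < l)"
      by (intro exI[of _ "n + int k"]) auto
  qed
  finally show ?thesis by (simp add: ex_hits_within)
qed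

lemma last_exit_eq_reversed_first_entrance:
  "last_exit S n x = - first_entrance S (- n) (\<lambda>k. x (- k))"
proof -
  have "(\<lambda>k. ereal (real_of_int k)) ` {k. k \<le> n \<and> x k \<in> S}
      = uminus ` (\<lambda>k. ereal (real_of_int k)) ` {k. k \<ge> - n \<and> x (- k) \<in> S}"
  proof -
    have "{k. k \<le> n \<and> x k \<in> S} = uminus ` {k. k \<ge> - n \<and> x (- k) \<in> S}"
      by (auto simp: image_iff intro!: exI[of _ "- _"])
    then show ?thesis by (simp add: image_image)
  qed
  then show ?thesis
    unfolding last_exit_def first_entrance_def by (simp add: ereal_Sup_uminus_image_eq)
qed

text \<open>Reversing time turns last exits into first entrances, so the backward event is a hitting event
  of the reversed path.\<close>

lemma last_exit_less_iff:
  "last_exit R n x < last_exit S n x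
    \<longleftrightarrow> (\<exists>p. hits_within S R (\<lambda>l. x (n - int l)) p)"
  using first_entrance_less_iff[of S "- n" "\<lambda>k. x (- k)" R]
  by (simp add: last_exit_eq_reversed_first_entrance)

section \<open>The chain, its time reversal and the started chain as Markov paths\<close>

lemma markov_chain_step:
  assumes mc: "markov_chain \<Omega> X P"
  shows "\<P>(\<omega> in \<Omega>. (\<forall>l\<in>{n - int k..n}. X l \<omega> = x l) \<and> X (n + 1) \<omega> = j)
    = \<P>(\<omega> in \<Omega>. \<forall>l\<in>{n - int k..n}. X l \<omega> = x l) * P n $ x n $ j"
proof -
  interpret prob_space \<Omega> using mc by (simp add: markov_chain_def)
  have [measurable]: "X n \<in> measurable \<Omega> (count_space UNIV)" for n
    using mc by (simp add: markov_chain_def)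
  let ?G = "\<lambda>\<omega>. \<forall>l\<in>{n - int k..n}. X l \<omega> = x l"
  \<comment> \<open>The conditional law is prescribed only for a past of positive probability; otherwise both
    sides vanish.\<close>
  show ?thesis
  proof (cases "\<P>(\<omega> in \<Omega>. ?G \<omega>) > 0")
    case True
    then have "\<P>(\<omega> in \<Omega>. X (n + 1) \<omega> = j \<bar> ?G \<omega>) = P n $ x n $ j"
      using mc unfolding markov_chain_def by blast
    with True show ?thesis
      by (simp add: cond_prob_def field_simps conj_commute)
  next
    case False
    then have z: "\<P>(\<omega> in \<Omega>. ?G \<omega>) = 0"
      using measure_nonneg[of \<Omega> "{\<omega> \<in> space \<Omega>. ?G \<omega>}"] by linarith
    have "\<P>(\<omega> in \<Omega>. ?G \<omega> \<and> X (n + 1) \<omega> = j) \<le> \<P>(\<omega> in \<Omega>. ?G \<omega>)"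
      by (intro finite_measure_mono) auto
    with z show ?thesis
      using measure_nonneg[of \<Omega> "{\<omega> \<in> space \<Omega>. ?G \<omega> \<and> X (n + 1) \<omega> = j}"] by simp
  qed
qed

lemma markov_path_forward:
  assumes mc: "markov_chain \<Omega> X P"
  shows "markov_path \<Omega> (\<lambda>l. X (n + int l)) (\<lambda>l i j. P (n + int l) $ i $ j)"
proof -
  interpret prob_space \<Omega> using mc by (simp add: markov_chain_def)
  show ?thesis
  proof
    show "X (n + int l) \<in> measurable \<Omega> (count_space UNIV)" for l
      using mc by (simp add: markov_chain_def)
    fix k x
    have cyl: "(\<forall>l\<in>{n + int k - int k..n + int k}. X l \<omega> = x (nat (l - n)))
        \<longleftrightarrow> (\<forall>l\<le>k. X (n + int l) \<omega> = x l)" for \<omega>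
    proof safe
      fix l assume "\<forall>l\<in>{n + int k - int k..n + int k}. X l \<omega> = x (nat (l - n))" "l \<le> k"
      then show "X (n + int l) \<omega> = x l" by (auto dest!: bspec[of _ _ "n + int l"])
    next
      fix l assume "\<forall>l\<le>k. X (n + int l) \<omega> = x l" "l \<in> {n + int k - int k..n + int k}"
      then show "X l \<omega> = x (nat (l - n))" by (auto dest!: spec[of _ "nat (l - n)"])
    qed
    have suc: "(\<forall>l\<le>Suc k. X (n + int l) \<omega> = x l)
        \<longleftrightarrow> (\<forall>l\<le>k. X (n + int l) \<omega> = x l) \<and> X (n + int k + 1) \<omega> = x (Suc k)" for \<omega>
      by (auto simp: le_Suc_eq add.assoc add.commute[of 1])
    show "\<P>(\<omega> in \<Omega>. \<forall>l\<le>Suc k. X (n + int l) \<omega> = x l)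
      = \<P>(\<omega> in \<Omega>. \<forall>l\<le>k. X (n + int l) \<omega> = x l) * P (n + int k) $ x k $ x (Suc k)"
      unfolding suc
      using markov_chain_step[OF mc, of "n + int k" k "\<lambda>t. x (nat (t - n))" "x (Suc k)"]
      unfolding cyl by simp
  qed
qed

lemma (in markov_path) prob_cylinder:
  "\<P>(\<omega> in N. \<forall>l\<le>k. Y l \<omega> = x l)
    = \<P>(\<omega> in N. Y 0 \<omega> = x 0) * (\<Prod>l<k. Q l (x l) (x (Suc l)))"
  by (induction k) (simp_all add: path_step)

text \<open>The probability of a cylinder is \<open>\<pi>\<close> at its earliest state times a product of forward transition
  probabilities. Extending the cylinder by one earlier state \<open>j\<close> before \<open>i\<close> replaces the factor
  \<open>\<pi>\<^sub>m i\<close> by \<open>\<pi>\<^sub>m\<^sub>-\<^sub>1 j * P\<^sub>m\<^sub>-\<^sub>1 j i\<close>, and the quotient of the two is exactly the backward transition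
  probability. This is why the reversed chain is Markov with these transition probabilities.\<close>

lemma markov_path_backward:
  assumes mc: "markov_chain \<Omega> X P" and stat: "M_stationary \<Omega> X \<pi>"
  shows "markov_path \<Omega> (\<lambda>l. X (n - int l)) (\<lambda>l. backward_transition \<Omega> X \<pi> (n - int l))"
proof -
  interpret prob_space \<Omega> using mc by (simp add: markov_chain_def)
  have [measurable]: "X n \<in> measurable \<Omega> (count_space UNIV)" for n
    using mc by (simp add: markov_chain_def)
  have p: "\<P>(\<omega> in \<Omega>. X n \<omega> = a) = \<pi> n $ a" for n a
    using stat by (simp add: M_stationary_def)
  have cyl: "\<P>(\<omega> in \<Omega>. \<forall>l\<le>k. X (n - int l) \<omega> = x l)
      = \<pi> (n - int k) $ x k * (\<Prod>l<k. P (n - int (Suc l)) $ x (Suc l) $ x l)" for k x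
  proof -
    interpret F: markov_path \<Omega> "\<lambda>l. X (n - int k + int l)" "\<lambda>l i j. P (n - int k + int l) $ i $ j"
      by (rule markov_path_forward[OF mc])
    have rev: "(\<forall>l\<le>k. X (n - int l) \<omega> = x l)
        \<longleftrightarrow> (\<forall>l\<le>k. X (n - int k + int l) \<omega> = x (k - l))" for \<omega>
    proof safe
      fix l assume "\<forall>l\<le>k. X (n - int l) \<omega> = x l" "l \<le> k"
      then show "X (n - int k + int l) \<omega> = x (k - l)"
        by (auto dest!: spec[of _ "k - l"] simp: of_nat_diff algebra_simps)
    next
      fix l assume "\<forall>l\<le>k. X (n - int k + int l) \<omega> = x (k - l)" "l \<le> k"
      then show "X (n - int l) \<omega> = x l"
        by (auto dest!: spec[of _ "k - l"] simp: of_nat_diff algebra_simps)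
    qed
    have "(\<Prod>l<k. P (n - int k + int l) $ x (k - l) $ x (k - Suc l))
        = (\<Prod>l<k. P (n - int (Suc l)) $ x (Suc l) $ x l)"
      by (subst prod.nat_diff_reindex[symmetric])
        (intro prod.cong, auto simp: of_nat_diff algebra_simps Suc_diff_Suc)
    then show ?thesis
      unfolding rev using F.prob_cylinder[of k "\<lambda>l. x (k - l)"] by (simp add: p)
  qed
  show ?thesis
  proof
    show "X (n - int l) \<in> measurable \<Omega> (count_space UNIV)" for l by measurable
    fix k x
    show "\<P>(\<omega> in \<Omega>. \<forall>l\<le>Suc k. X (n - int l) \<omega> = x l)
      = \<P>(\<omega> in \<Omega>. \<forall>l\<le>k. X (n - int l) \<omega> = x l)
        * backward_transition \<Omega> X \<pi> (n - int k) (x k) (x (Suc k))"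
    proof (cases "\<pi> (n - int k) $ x k > 0")
      case True
      have shift: "n - int k - 1 = n - int (Suc k)" by simp
      show ?thesis
        unfolding cyl backward_transition_eq[where i = "x k", OF mc stat True] shift
        using True by simp
    next
      case False
      moreover have "\<pi> (n - int k) $ x k \<ge> 0"
        unfolding p[symmetric] by (rule measure_nonneg)
      ultimately have z: "\<P>(\<omega> in \<Omega>. X (n - int k) \<omega> = x k) = 0" by (simp add: p)
      have "\<P>(\<omega> in \<Omega>. \<forall>l\<le>Suc k. X (n - int l) \<omega> = x l) \<le> \<P>(\<omega> in \<Omega>. X (n - int k) \<omega> = x k)"
        by (intro finite_measure_mono) auto
      with z False show ?thesis
        using measure_nonneg[of \<Omega> "{\<omega> \<in> space \<Omega>. \<forall>l\<le>Suc k. X (n - int l) \<omega> = x l}"]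
        by (simp add: backward_transition_def)
    qed
  qed
qed

lemma emeasure_started_kernel_Suc:
  fixes i :: "'s::finite"
  assumes "row_stochastic (P (n + int l))"
  shows "emeasure (started_kernel P n i (Suc l) y) {j} = ennreal (P (n + int l) $ y l $ j)"
proof -
  have nonneg: "0 \<le> P (n + int l) $ y l $ j" for j
    using assms by (simp add: row_stochastic_def)
  have "(\<integral>\<^sup>+j. ennreal (P (n + int l) $ y l $ j) \<partial>count_space UNIV) = 1"
    using assms nonneg by (simp add: nn_integral_count_space_finite sum_ennreal row_stochastic_def)
  then have "pmf (embed_pmf (\<lambda>j. P (n + int l) $ y l $ j)) j = P (n + int l) $ y l $ j"
    by (intro pmf_embed_pmf nonneg) auto
  then show ?thesis
    by (simp add: started_kernel_def emeasure_pmf_single)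
qed

text \<open>The started law is an Ionescu-Tulcea measure, so its value on a cylinder is that of the
  finite composition of kernels, and one more kernel contributes one more transition probability:
  on a cylinder the past is a single point, hence the integral over the past is a product.\<close>

lemma markov_path_started_law:
  fixes i :: "'s::finite"
  assumes stoch: "\<And>n. row_stochastic (P n)"
  shows "markov_path (started_law P n i) (\<lambda>l y. y l) (\<lambda>l i j. P (n + int l) $ i $ j)"
    and "measure (started_law P n i) {y \<in> space (started_law P n i). y 0 = i} = 1"
proof -
  interpret IT: Ionescu_Tulcea "started_kernel P n i" "\<lambda>_. count_space (UNIV :: 's set)"
    by (rule Ionescu_Tulcea_started_kernel)
  interpret prob_space "started_law P n i" by (rule prob_space_started_law)
  let ?M = "\<lambda>_::nat. count_space (UNIV :: 's set)"
  let ?c = "\<lambda>k (x::nat \<Rightarrow> 's). PiE {0..<k} (\<lambda>l. {x l})"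
  let ?u = "\<lambda>_::nat. undefined :: 's"
  have space: "space (started_law P n i) = UNIV"
    using sets_eq_imp_space_eq[OF sets_started_law[of P n i]] by (simp add: space_PiM)
  have [measurable]: "?c k x \<in> sets (PiM {0..<k} ?M)" for k x
    by (intro sets_PiM_I_finite) auto
  have to_C: "emeasure (started_law P n i) {y. \<forall>l<k. y l = x l} = emeasure (IT.C 0 k ?u) (?c k x)" for k x
  proof -
    have "{y. \<forall>l<k. y l = x l} = IT.PF.emb UNIV {0..<k} (?c k x)"
      by (auto simp: prod_emb_def PiE_iff)
    moreover have "IT.PF.emb {0..<k} {0..<k} (?c k x) = ?c k x"
      by (intro prod_emb_id) auto
    ultimately show ?thesis
      unfolding started_law_def by (simp add: IT.lim IT.emeasure_CI[of "{0..<k}" k])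
  qed
  have C_Suc: "emeasure (IT.C 0 (Suc k) ?u) (?c (Suc k) x)
      = emeasure (IT.C 0 k ?u) (?c k x) * emeasure (started_kernel P n i k x) {x k}" for k x
  proof -
    have sp: "?u \<in> space (PiM {0..<0} ?M)" by simp
    have "emeasure (IT.C 0 (Suc k) ?u) (?c (Suc k) x)
        = (\<integral>\<^sup>+y. emeasure (IT.eP k y) (?c (Suc k) x) \<partial>IT.C 0 k ?u)"
      using IT.measurable_eP[of k]
      by (simp, subst emeasure_bind[where N = "PiM {0..<Suc k} ?M"])
        (auto simp: IT.space_C[OF sp] measurable_cong_sets[OF IT.sets_C[OF sp]])
    also have "\<dots> = (\<integral>\<^sup>+y. emeasure (started_kernel P n i k x) {x k} * indicator (?c k x) y \<partial>IT.C 0 k ?u)"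
    proof (rule nn_integral_cong)
      fix y assume "y \<in> space (IT.C 0 k ?u)"
      then have y: "y \<in> space (PiM {0..<k} ?M)" using IT.space_C[OF sp, of k] by simp
      have "emeasure (IT.eP k y) (?c (Suc k) x)
          = emeasure (started_kernel P n i k y) ((\<lambda>j. y(k := j)) -` ?c (Suc k) x)"
        using IT.emeasure_eP[OF y, of "?c (Suc k) x"] by simp
      also have "(\<lambda>j. y(k := j)) -` ?c (Suc k) x = (if y \<in> ?c k x then {x k} else {})"
        using y by (auto simp: space_PiM PiE_iff extensional_def less_Suc_eq split: if_splits)
      also have "emeasure (started_kernel P n i k y) \<dots>
          = emeasure (started_kernel P n i k x) {x k} * indicator (?c k x) y"
      proof (cases "y \<in> ?c k x")
        case True
        then have "started_kernel P n i k y = started_kernel P n i k x"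
          by (auto simp: started_kernel_def PiE_iff split: nat.split)
        with True show ?thesis by simp
      qed simp
      finally show "emeasure (IT.eP k y) (?c (Suc k) x)
          = emeasure (started_kernel P n i k x) {x k} * indicator (?c k x) y" .
    qed
    also have "\<dots> = emeasure (IT.C 0 k ?u) (?c k x) * emeasure (started_kernel P n i k x) {x k}"
      by (subst nn_integral_cmult_indicator) (auto simp: IT.sets_C[OF sp] mult.commute)
    finally show ?thesis .
  qed
  have step: "emeasure (started_law P n i) {y. \<forall>l<Suc k. y l = x l}
      = emeasure (started_law P n i) {y. \<forall>l<k. y l = x l} * emeasure (started_kernel P n i k x) {x k}" for k x
    unfolding to_C C_Suc ..
  show "markov_path (started_law P n i) (\<lambda>l y. y l) (\<lambda>l i j. P (n + int l) $ i $ j)"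
  proof
    show "(\<lambda>y. y l) \<in> measurable (started_law P n i) (count_space UNIV)" for l
      unfolding measurable_cong_sets[OF sets_started_law refl]
      by (rule measurable_component_singleton) simp
    fix k x
    have "emeasure (started_law P n i) {y. \<forall>l<Suc (Suc k). y l = x l}
      = emeasure (started_law P n i) {y. \<forall>l<Suc k. y l = x l} * ennreal (P (n + int k) $ x k $ x (Suc k))"
      unfolding step[of "Suc k"] by (simp add: emeasure_started_kernel_Suc stoch)
    then have "measure (started_law P n i) {y. \<forall>l<Suc (Suc k). y l = x l}
      = measure (started_law P n i) {y. \<forall>l<Suc k. y l = x l} * P (n + int k) $ x k $ x (Suc k)"
      using stoch[of "n + int k"]
      by (simp add: measure_def enn2real_mult row_stochastic_def)
    then show "\<P>(y in started_law P n i. \<forall>l\<le>Suc k. y l = x l)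
      = \<P>(y in started_law P n i. \<forall>l\<le>k. y l = x l) * P (n + int k) $ x k $ x (Suc k)"
      by (simp add: space less_Suc_eq_le)
  qed
  have "emeasure (started_law P n i) {y. \<forall>l<Suc 0. y l = i} = 1"
    using step[of 0 "\<lambda>_. i"] emeasure_space_1
    by (simp add: space started_kernel_def emeasure_pmf_single)
  then show "measure (started_law P n i) {y \<in> space (started_law P n i). y 0 = i} = 1"
    by (simp add: space measure_def)
qed

section \<open>Committors as limits of finite-step hitting probabilities\<close>

lemma forward_committor_limit:
  fixes X :: "int \<Rightarrow> 'w \<Rightarrow> 's::finite"
  assumes mc: "markov_chain \<Omega> X P" and stoch: "\<And>n. row_stochastic (P n)" and "A \<inter> B = {}"
  shows "(\<lambda>p. hit_prob B A p (\<lambda>l i j. P (n + int l) $ i $ j) i) \<longlonglongrightarrow> forward_committor \<Omega> X P A B n i"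
proof -
  have BA: "B \<inter> A = {}" using assms(3) by blast
  show ?thesis
  proof (cases "\<P>(\<omega> in \<Omega>. X n \<omega> = i) > 0")
    case True
    interpret markov_path \<Omega> "\<lambda>l. X (n + int l)" "\<lambda>l i j. P (n + int l) $ i $ j"
      by (rule markov_path_forward[OF mc])
    show ?thesis
      using cond_prob_hits[OF BA, of i] True
      by (simp add: forward_committor_def first_entrance_less_iff)
  next
    case False
    \<comment> \<open>The started chain is in \<open>i\<close> at its initial time almost surely, so conditioning on this
      event changes nothing.\<close>
    interpret markov_path "started_law P n i" "\<lambda>l y. y l" "\<lambda>l i j. P (n + int l) $ i $ j"
      by (rule markov_path_started_law[OF stoch])
    have start: "\<P>(y in started_law P n i. y 0 = i) = 1"
      by (rule markov_path_started_law[OF stoch])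
    have [measurable]: "Measurable.pred (started_law P n i) (\<lambda>y. hits_within B A (\<lambda>l. y l) p)" for p
      using measurable_hits_within[of B A 0 p] by simp
    have "AE y in started_law P n i. y 0 = i"
      using start by (subst prob_Collect_eq_1[symmetric]) auto
    then have "\<P>(y in started_law P n i. y 0 = i \<and> (\<exists>p. hits_within B A y p))
        = \<P>(y in started_law P n i. \<exists>p. hits_within B A y p)"
      by (intro finite_measure_eq_AE) auto
    with prob_hits_from_start[OF BA, of i] False start show ?thesis
      by (simp add: forward_committor_def first_entrance_less_iff)
  qed
qed

text \<open>At a state of probability zero the backward transition probabilities vanish, so \<open>hit_prob\<close> is
  constant in the horizon and equals the conventional value.\<close>

lemma backward_committor_limit:
  fixes X :: "int \<Rightarrow> 'w \<Rightarrow> 's::finite"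
  assumes mc: "markov_chain \<Omega> X P" and stat: "M_stationary \<Omega> X \<pi>" and AB: "A \<inter> B = {}"
  shows "(\<lambda>p. hit_prob A B p (\<lambda>l. backward_transition \<Omega> X \<pi> (n - int l)) i)
    \<longlonglongrightarrow> backward_committor \<Omega> X A B n i"
proof (cases "\<P>(\<omega> in \<Omega>. X n \<omega> = i) > 0")
  case True
  interpret markov_path \<Omega> "\<lambda>l. X (n - int l)" "\<lambda>l. backward_transition \<Omega> X \<pi> (n - int l)"
    by (rule markov_path_backward[OF mc stat])
  show ?thesis
    using cond_prob_hits[OF AB, of i] True
    by (simp add: backward_committor_def last_exit_less_iff)
next
  case False
  then have "backward_transition \<Omega> X \<pi> n i j = 0" for j
    using stat by (simp add: backward_transition_def M_stationary_def)
  then have "hit_prob A B p (\<lambda>l. backward_transition \<Omega> X \<pi> (n - int l)) i = (if i \<in> A then 1 else 0)" for p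
    by (cases p) auto
  with False show ?thesis by (simp add: backward_committor_def)
qed

lemma periodic_cong:
  assumes "periodic M f" "[n = m] (mod int M)"
  shows "f n = f m"
proof -
  have nat_shift: "f (a + int M * int k) = f a" for a k
  proof (induction k)
    case (Suc k)
    then show ?case
      using assms(1)[unfolded periodic_def, rule_format, of "a + int M * int k"]
      by (simp add: algebra_simps)
  qed simp
  obtain d where d: "n = m + int M * d"
    using assms(2) by (metis add.commute cong_iff_lin cong_sym)
  show ?thesis
  proof (cases "d \<ge> 0")
    case True
    with nat_shift[of m "nat d"] d show ?thesis by simp
  next
    case False
    with nat_shift[of n "nat (- d)"] d show ?thesis by simp
  qed
qed

lemma backward_transition_periodic:
  fixes X :: "int \<Rightarrow> 'w \<Rightarrow> 's::finite"
  assumes "markov_chain \<Omega> X P" "M_stationary \<Omega> X \<pi>" "periodic M P" "periodic M \<pi>"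
  shows "periodic M (backward_transition \<Omega> X \<pi>)"
  unfolding periodic_def
proof (intro allI ext)
  fix n i j
  have "P (n + int M - 1) = P (n - 1)" "\<pi> (n + int M - 1) = \<pi> (n - 1)" "\<pi> (n + int M) = \<pi> n"
    using assms(3,4)[unfolded periodic_def, rule_format, of "n - 1"]
      assms(4)[unfolded periodic_def, rule_format, of n] by (simp_all add: algebra_simps)
  then show "backward_transition \<Omega> X \<pi> (n + int M) i j = backward_transition \<Omega> X \<pi> n i j"
    using backward_transition_eq[OF assms(1,2), of "n + int M" i j]
      backward_transition_eq[OF assms(1,2), of n i j]
    by (cases "\<pi> n $ i > 0") (simp_all add: backward_transition_def)
qed

theorem theorem4p4:
  fixes \<Omega> :: "'w measure"
    and X :: "int \<Rightarrow> 'w \<Rightarrow> 's :: finite"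
    and P :: "int \<Rightarrow> real^'s^'s"
    and \<pi> :: "int \<Rightarrow> real^'s"
    and M :: nat
    and A B C :: "'s set"
    and qf qb :: "int \<Rightarrow> 's \<Rightarrow> real"
  assumes "A \<noteq> {}" and "B \<noteq> {}" and "A \<inter> B = {}" and "C = - (A \<union> B)" and "C \<noteq> {}"
    and "M \<ge> 1"
    and "\<And>n. row_stochastic (P n)"
    and "periodic M P"
    and "irreducible_matrix (transition_product P 0 M)"
    and "stationary_family P M \<pi>"
    and "markov_chain \<Omega> X P"
    and "M_stationary \<Omega> X \<pi>"
  defines "qf \<equiv> forward_committor \<Omega> X P A B"
    and "qb \<equiv> backward_committor \<Omega> X A B"
  shows "(\<forall>n m. [n = m] (mod int M) \<longrightarrow> qf n = qf m \<and> qb n = qb m) \<and>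
         (qf (int M) = qf 0) \<and>
         (\<forall>m\<in>{0..int M - 1}.
           (\<forall>i\<in>C. qf m i = (\<Sum>j\<in>UNIV. P m $ i $ j * qf (m + 1) j)) \<and>
           (\<forall>i\<in>A. qf m i = 0) \<and>
           (\<forall>i\<in>B. qf m i = 1)) \<and>
         (qb (int M) = qb 0) \<and>
         (\<forall>m\<in>{1..int M}.
           (\<forall>i\<in>C. qb m i = (\<Sum>j\<in>UNIV. backward_transition \<Omega> X \<pi> m i j * qb (m - 1) j)) \<and>
           (\<forall>i\<in>B. qb m i = 0) \<and>
           (\<forall>i\<in>A. qb m i = 1))"
proof -
  \<comment> \<open>Transition probabilities as seen by a path that leaves time \<open>n\<close>, forwards (\<open>F\<close>) and backwards
    (\<open>G\<close>). Dropping the first step moves the starting time by one.\<close>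
  define F where "F n = (\<lambda>l i j. P (n + int l) $ i $ j)" for n
  define G where "G n = (\<lambda>l. backward_transition \<Omega> X \<pi> (n - int l))" for n
  note forward_limit = forward_committor_limit[OF assms(11,7,3), folded F_def qf_def]
  note backward_limit = backward_committor_limit[OF assms(11,12,3), folded G_def qb_def]
  have F_Suc: "(\<lambda>l. F n (Suc l)) = F (n + 1)" for n
    by (simp add: F_def algebra_simps)
  have G_Suc: "(\<lambda>l. G n (Suc l)) = G (n - 1)" for n
    by (simp add: G_def algebra_simps)
  have forward_rec: "qf n i = (if i \<in> B then 1 else if i \<in> A then 0
      else (\<Sum>j\<in>UNIV. P n $ i $ j * qf (n + 1) j))" for n i
    using hit_prob_limit_rec[OF forward_limit[of n i], of "qf (n + 1)"] forward_limit[of "n + 1"]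
    unfolding F_Suc by (simp add: F_def)
  have backward_rec: "qb n i = (if i \<in> A then 1 else if i \<in> B then 0
      else (\<Sum>j\<in>UNIV. backward_transition \<Omega> X \<pi> n i j * qb (n - 1) j))" for n i
    using hit_prob_limit_rec[OF backward_limit[of n i], of "qb (n - 1)"] backward_limit[of "n - 1"]
    unfolding G_Suc by (simp add: G_def)
  have period: "qf n = qf m \<and> qb n = qb m" if nm: "[n = m] (mod int M)" for n m
  proof -
    have "periodic M \<pi>" using assms(10) by (simp add: stationary_family_def)
    note periodic_back = backward_transition_periodic[OF assms(11,12,8) this]
    have "F n = F m"
      using periodic_cong[OF assms(8) cong_add[OF nm cong_refl]] by (simp add: F_def)
    moreover have "G n = G m"
      using periodic_cong[OF periodic_back cong_diff[OF nm cong_refl]] by (simp add: G_def)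
    ultimately show ?thesis
      using LIMSEQ_unique[OF forward_limit[of n] forward_limit[of m, folded \<open>F n = F m\<close>]]
        LIMSEQ_unique[OF backward_limit[of n] backward_limit[of m, folded \<open>G n = G m\<close>]]
      by (simp add: fun_eq_iff)
  qed
  have "[int M = 0] (mod int M)" by (simp add: cong_def)
  note wrap = period[OF this]
  show ?thesis
    using period wrap forward_rec backward_rec assms(3,4) by auto
qed

end
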